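(* For every even integer $n \geq 2$, $\dim_E(CS_n) = \frac{3n}{2}+2$.
   Context: For a connected graph $G$, $d_G(u,v)$ is the number of edges in a shortest path between vertices $u$ and $v$. For a vertex $u$ and an edge $e = vw$, the distance is $d_G(e,u) = \min\{d_G(v,u), d_G(w,u)\}$. A set $S \subseteq V(G)$ is an edge resolving set of $G$ if for every pair of distinct edges $e,f \in E(G)$ there is $w \in S$ with $d_G(w,e) \neq d_G(w,f)$. The edge metric dimension $\dim_E(G)$ is the minimum cardinality of an edge resolving set of $G$. The chain silicate $CS_n$ consists of $n$ tetrahedra joined linearly (in a single row): it is the simple graph that is the union of $n$ complete graphs $R_1,\dots,R_n$, each isomorphic to $K_4$, such that for $1 \le i \le n-1$ the graphs $R_i$ and $R_{i+1}$ share exactly one vertex, these $n-1$ shared vertices are pairwise distinct, and $R_i, R_j$ share no vertex when $|i-j| \geq 2$. It has $3n+1$ vertices and $6n$ edges. *)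

theory Defs
  imports Main
begin

record 'a graph =
  verts :: "'a set"
  edges :: "'a set set"

definition simple_graph :: "'a graph \<Rightarrow> bool" where
  "simple_graph G \<longleftrightarrow> (\<forall>e\<in>edges G. e \<subseteq> verts G \<and> card e = 2)"

text \<open>A path is given by its nonempty list of pairwise distinct vertices;
  it has one edge fewer than vertices.\<close>

definition path_between :: "'a graph \<Rightarrow> 'a \<Rightarrow> 'a list \<Rightarrow> 'a \<Rightarrow> bool" where
  "path_between G u p v \<longleftrightarrow>
     p \<noteq> [] \<and> hd p = u \<and> last p = v \<and> distinct p \<and> set p \<subseteq> verts G \<and>
     (\<forall>i. Suc i < length p \<longrightarrow> {p ! i, p ! Suc i} \<in> edges G)"

text \<open>The value is meaningful only if some path joins the two vertices, so the notions
  below are intended for connected graphs.\<close>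

definition gdist :: "'a graph \<Rightarrow> 'a \<Rightarrow> 'a \<Rightarrow> nat" where
  "gdist G u v = (LEAST k. \<exists>p. path_between G u p v \<and> length p = Suc k)"

definition edge_dist :: "'a graph \<Rightarrow> 'a set \<Rightarrow> 'a \<Rightarrow> nat" where
  "edge_dist G e u = Min ((\<lambda>v. gdist G v u) ` e)"

lemma edge_dist_pair: "edge_dist G {v, w} u = min (gdist G v u) (gdist G w u)"
  by (simp add: edge_dist_def)

definition edge_resolving :: "'a graph \<Rightarrow> 'a set \<Rightarrow> bool" where
  "edge_resolving G S \<longleftrightarrow>
     S \<subseteq> verts G \<and>
     (\<forall>e\<in>edges G. \<forall>f\<in>edges G. e \<noteq> f \<longrightarrow> (\<exists>w\<in>S. edge_dist G e w \<noteq> edge_dist G f w))"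

text \<open>Finiteness is required because \<^const>\<open>card\<close> is 0 on infinite sets.\<close>

definition edge_metric_dim :: "'a graph \<Rightarrow> nat" where
  "edge_metric_dim G = (LEAST k. \<exists>S. edge_resolving G S \<and> finite S \<and> card S = k)"

definition is_K4 :: "'a graph \<Rightarrow> bool" where
  "is_K4 R \<longleftrightarrow> card (verts R) = 4 \<and> edges R = {e. e \<subseteq> verts R \<and> card e = 2}"

text \<open>This determines the graph up to isomorphism; \<open>s i\<close> is the vertex shared by the
  \<open>i\<close>-th and the next tetrahedron.\<close>

definition is_chain_silicate :: "nat \<Rightarrow> 'a graph \<Rightarrow> bool" where
  "is_chain_silicate n G \<longleftrightarrow>
     (\<exists>(R :: nat \<Rightarrow> 'a graph) (s :: nat \<Rightarrow> 'a).
        (\<forall>i\<in>{1..n}. is_K4 (R i)) \<and>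
        verts G = (\<Union>i\<in>{1..n}. verts (R i)) \<and>
        edges G = (\<Union>i\<in>{1..n}. edges (R i)) \<and>
        (\<forall>i\<in>{1..<n}. verts (R i) \<inter> verts (R (i + 1)) = {s i}) \<and>
        inj_on s {1..<n} \<and>
        (\<forall>i\<in>{1..n}. \<forall>j\<in>{1..n}. i + 2 \<le> j \<longrightarrow> verts (R i) \<inter> verts (R j) = {}))"

lemma chain_silicate_simple_graph:
  assumes "is_chain_silicate n G"
  shows "simple_graph G"
  using assms unfolding is_chain_silicate_def simple_graph_def is_K4_def by fastforce

text \<open>A chain silicate exists for every length.\<close>

lemma chain_silicate_exists: "\<exists>G :: nat graph. is_chain_silicate n G"
proof -
  define A :: "nat \<Rightarrow> nat set" where "A i = {3 * (i - 1)..3 * (i - 1) + 3}" for i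
  define R :: "nat \<Rightarrow> nat graph"
    where "R i = \<lparr>verts = A i, edges = {e. e \<subseteq> A i \<and> card e = 2}\<rparr>" for i
  define G :: "nat graph"
    where "G = \<lparr>verts = (\<Union>i\<in>{1..n}. verts (R i)), edges = (\<Union>i\<in>{1..n}. edges (R i))\<rparr>"
  have K4: "is_K4 (R i)" for i
    by (simp add: is_K4_def R_def A_def)
  have shared: "verts (R i) \<inter> verts (R (i + 1)) = {3 * i}" if "i \<in> {1..<n}" for i
    using that by (auto simp: R_def A_def)
  have disjoint: "verts (R i) \<inter> verts (R j) = {}" if "i \<in> {1..n}" "i + 2 \<le> j" for i j
    using that by (auto simp: R_def A_def)
  have "inj_on (\<lambda>i::nat. 3 * i) {1..<n}"
    by (simp add: inj_on_def)
  with K4 shared disjoint have "is_chain_silicate n G"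
    unfolding is_chain_silicate_def
    by (intro exI[of _ R] exI[of _ "\<lambda>i. 3 * i"]) (simp add: G_def)
  then show ?thesis ..
qed

end

theory Submission
  imports Defs
begin

text \<open>
  Call a vertex inner if it lies in only one tetrahedron; the other vertices are the \<open>n - 1\<close>
  shared ones, so there are \<open>2 n + 2\<close> inner vertices.

  Lower bound. All neighbours of an inner vertex \<open>x\<close> lie in its tetrahedron, so any other
  vertex \<open>c\<close> of that tetrahedron is at least as close as \<open>x\<close> to every vertex except \<open>x\<close> itself.
  Hence the edge \<open>cx\<close> has the distance of \<open>c\<close> from every vertex other than \<open>x\<close>
  (\<open>edge_dist_at_inner\<close>).  If two inner vertices \<open>x\<close> and \<open>y\<close> with a common neighbour \<open>c\<close> are both
  outside \<open>S\<close>, then \<open>S\<close> cannot tell \<open>cx\<close> from \<open>cy\<close>.  Inner vertices of the same or of consecutive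
  tetrahedra have a common neighbour, so an edge resolving set omits at most one inner vertex
  from each of the \<open>n / 2\<close> pairs of tetrahedra \<open>2 k - 1, 2 k\<close>
  (\<open>missing_inner_unique\<close>).  This gives
  \<open>card S \<ge> 2 n + 2 - n / 2 = 3 n / 2 + 2\<close>.

  Upper bound. Let \<open>S\<close> consist of all inner vertices except one in each odd-numbered
  tetrahedron.  Beyond connectedness, no distances have to be computed: it is enough to see from a
  landmark whether an edge contains it (distance 0), and whether the edge touches the tetrahedron
  of the landmark (distance at most 1).  So if two edges have the same distances from all of \<open>S\<close>,
  they contain the same elements of \<open>S\<close> and touch the same tetrahedra.  Within one
  tetrahedron this determines an edge (\<open>same_block_edges_eq\<close>).  Edges of different
  tetrahedra can agree in this way only if the tetrahedra are consecutive and each has an inner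
  vertex outside \<open>S\<close> (\<open>different_block_edges\<close>), but one of two consecutive numbers is even.
\<close>

section \<open>Paths and distances\<close>

lemma path_suffix:
  assumes "path_between G u p v" "x \<in> set p"
  shows "\<exists>q. path_between G x q v \<and> length q \<le> length p"
proof -
  obtain ys zs where p: "p = ys @ x # zs"
    using assms(2) by (meson split_list)
  have edge: "{(x # zs) ! i, (x # zs) ! Suc i} \<in> edges G" if "Suc i < length (x # zs)" for i
  proof -
    have "Suc (length ys + i) < length p" using that p by simp
    then have "{p ! (length ys + i), p ! Suc (length ys + i)} \<in> edges G"
      using assms(1) unfolding path_between_def by blast
    then show ?thesis
      unfolding p using nth_append_length_plus[of ys "x # zs" i]
        nth_append_length_plus[of ys "x # zs" "Suc i"] by (metis add_Suc_right)
  qed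
  have "path_between G x (x # zs) v"
    using assms(1) edge unfolding path_between_def p by auto
  then show ?thesis using p by (intro exI[of _ "x # zs"]) simp
qed

text \<open>Prepending \<open>x\<close> may break distinctness; then \<open>x\<close> is already on the path and a suffix of it
  does the job.\<close>

lemma path_extend:
  assumes "path_between G y p v" "x \<in> verts G" "{x, y} \<in> edges G"
  shows "\<exists>q. path_between G x q v \<and> length q \<le> Suc (length p)"
proof (cases "x \<in> set p")
  case True
  then show ?thesis using path_suffix[OF assms(1)] le_SucI by blast
next
  case False
  have "{(x # p) ! i, (x # p) ! Suc i} \<in> edges G" if "Suc i < length (x # p)" for i
    using that assms(1,3) unfolding path_between_def
    by (cases i) (auto simp: hd_conv_nth)
  then have "path_between G x (x # p) v"
    using assms False unfolding path_between_def by auto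
  then show ?thesis by (intro exI[of _ "x # p"]) simp
qed

lemma path_tail:
  assumes "path_between G u p v" "u \<noteq> v"
  obtains y q where "p = u # q" "{u, y} \<in> edges G" "path_between G y q v"
proof -
  obtain q where p: "p = u # q"
    using assms(1) unfolding path_between_def by (cases p) auto
  have ne: "q \<noteq> []" using assms p unfolding path_between_def by auto
  have step: "{p ! i, p ! Suc i} \<in> edges G" if "Suc i < length p" for i
    using assms(1) that unfolding path_between_def by blast
  have "{u, hd q} \<in> edges G"
    using step[of 0] ne unfolding p by (auto simp: hd_conv_nth)
  moreover have "{q ! i, q ! Suc i} \<in> edges G" if "Suc i < length q" for i
    using step[of "Suc i"] that unfolding p by simp
  then have "path_between G (hd q) q v"
    using assms(1) ne unfolding path_between_def p by auto
  ultimately show ?thesis using that p by blast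
qed

lemma gdist_le:
  assumes "path_between G u p v"
  shows "gdist G u v \<le> length p - 1"
proof -
  have "p \<noteq> []" using assms by (simp add: path_between_def)
  then have "length p = Suc (length p - 1)" by simp
  then show ?thesis unfolding gdist_def using assms by (intro Least_le) blast
qed

text \<open>The existence of some path is what makes the \<open>LEAST\<close> in the definition of the distance
  attained.\<close>

lemma shortest_path:
  assumes "path_between G u p v"
  obtains q where "path_between G u q v" "length q = Suc (gdist G u v)"
proof -
  have "p \<noteq> []" using assms by (simp add: path_between_def)
  then have "length p = Suc (length p - 1)" by simp
  then have "\<exists>k p. path_between G u p v \<and> length p = Suc k" using assms by blast
  then have "\<exists>p. path_between G u p v \<and> length p = Suc (gdist G u v)"
    unfolding gdist_def by (rule LeastI_ex)
  then show ?thesis using that by blast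
qed

lemma path_trivial: "v \<in> verts G \<Longrightarrow> path_between G v [v] v"
  by (simp add: path_between_def)

lemma gdist_eq_0_iff:
  assumes "path_between G u p v"
  shows "gdist G u v = 0 \<longleftrightarrow> u = v"
proof
  assume "gdist G u v = 0"
  then obtain q where "path_between G u q v" "length q = 1"
    using shortest_path[OF assms] by auto
  then show "u = v" by (auto simp: path_between_def length_Suc_conv)
next
  assume "u = v"
  moreover have "v \<in> verts G"
    using assms last_in_set unfolding path_between_def by blast
  ultimately show "gdist G u v = 0" using gdist_le[OF path_trivial, of v G] by simp
qed

lemma gdist_le_1_iff:
  assumes "path_between G u p v"
  shows "gdist G u v \<le> 1 \<longleftrightarrow> u = v \<or> {u, v} \<in> edges G"
proof
  assume *: "gdist G u v \<le> 1"
  show "u = v \<or> {u, v} \<in> edges G"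
  proof (rule disjCI)
    assume "{u, v} \<notin> edges G"
    obtain q where q: "path_between G u q v" "length q = Suc (gdist G u v)"
      using shortest_path[OF assms] by blast
    show "u = v"
    proof (rule ccontr)
      assume "u \<noteq> v"
      then obtain y r where r: "q = u # r" "{u, y} \<in> edges G" "path_between G y r v"
        using path_tail[OF q(1)] by blast
      then have "length r = 1"
        using q(2) * by (cases r) (auto simp: path_between_def)
      then have "y = v" using r(3) by (auto simp: path_between_def length_Suc_conv)
      then show False using r(2) \<open>{u, v} \<notin> edges G\<close> by simp
    qed
  qed
next
  assume *: "u = v \<or> {u, v} \<in> edges G"
  have "u \<in> verts G" "v \<in> verts G"
    using assms hd_in_set last_in_set unfolding path_between_def by blast+
  then have "\<exists>q. path_between G u q v \<and> length q \<le> 2"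
    using * path_extend[OF path_trivial, of v G u] path_trivial[of v G] by fastforce
  then show "gdist G u v \<le> 1" using gdist_le by fastforce
qed

lemma rtrancl_imp_path:
  assumes "(u, v) \<in> {(x, y). {x, y} \<in> edges G}\<^sup>*" "simple_graph G" "v \<in> verts G"
  shows "\<exists>p. path_between G u p v"
  using assms(1)
proof (induction rule: converse_rtrancl_induct)
  case base
  show ?case using path_trivial[OF assms(3)] by blast
next
  case (step x y)
  then obtain p where "path_between G y p v" by blast
  moreover have "x \<in> verts G" using step(1) assms(2) by (auto simp: simple_graph_def)
  ultimately show ?case using step(1) path_extend by fastforce
qed

text \<open>If \<open>c\<close> is equal or adjacent to every neighbour of \<open>b\<close>, then replacing \<open>b\<close> by \<open>c\<close> at the start
  of a shortest path from \<open>b\<close> yields a path from \<open>c\<close> that is not longer.  A path from \<open>b\<close> to \<open>b\<close>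
  itself has no second vertex, whence the condition \<open>b \<noteq> w\<close>.\<close>

lemma gdist_dominated:
  assumes "path_between G b p w" "b \<noteq> w" "c \<in> verts G"
    and dom: "\<And>x. {b, x} \<in> edges G \<Longrightarrow> x = c \<or> {c, x} \<in> edges G"
  shows "gdist G c w \<le> gdist G b w"
proof -
  obtain q where q: "path_between G b q w" "length q = Suc (gdist G b w)"
    using shortest_path[OF assms(1)] by blast
  obtain y r where r: "q = b # r" "{b, y} \<in> edges G" "path_between G y r w"
    using path_tail[OF q(1) assms(2)] by blast
  have "\<exists>t. path_between G c t w \<and> length t \<le> Suc (length r)"
    using dom[OF r(2)] path_extend[OF r(3) assms(3)] r(3) le_SucI by blast
  then obtain t where "path_between G c t w" "length t \<le> Suc (length r)" by blast
  then show ?thesis using gdist_le[of G c t w] q(2) r(1) by simp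
qed

section \<open>Structure of the chain\<close>

locale silicate_chain =
  fixes G :: "'a graph" and n :: nat and R :: "nat \<Rightarrow> 'a graph" and s :: "nat \<Rightarrow> 'a"
  assumes K4: "i \<in> {1..n} \<Longrightarrow> is_K4 (R i)"
    and verts_G: "verts G = (\<Union>i\<in>{1..n}. verts (R i))"
    and edges_G: "edges G = (\<Union>i\<in>{1..n}. edges (R i))"
    and shared: "i \<in> {1..<n} \<Longrightarrow> verts (R i) \<inter> verts (R (Suc i)) = {s i}"
    and inj_s: "inj_on s {1..<n}"
    and far: "i \<in> {1..n} \<Longrightarrow> j \<in> {1..n} \<Longrightarrow> i + 2 \<le> j \<Longrightarrow> verts (R i) \<inter> verts (R j) = {}"
    and n_pos: "1 \<le> n"
begin

abbreviation T :: "nat \<Rightarrow> 'a set" where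
  "T i \<equiv> verts (R i)"

definition inner :: "nat \<Rightarrow> 'a set" where
  "inner i = T i - s ` {1..<n}"

definition inners :: "'a set" where
  "inners = verts G - s ` {1..<n}"

lemma card_T: "i \<in> {1..n} \<Longrightarrow> card (T i) = 4"
  using K4 by (simp add: is_K4_def)

lemma finite_T: "i \<in> {1..n} \<Longrightarrow> finite (T i)"
  using card_T card.infinite by fastforce

lemma finite_verts: "finite (verts G)"
  using verts_G finite_T by simp

lemma edge_iff: "e \<in> edges G \<longleftrightarrow> (\<exists>i\<in>{1..n}. e \<subseteq> T i \<and> card e = 2)"
  using edges_G K4 by (simp add: is_K4_def)

lemma adjacent_iff: "{u, v} \<in> edges G \<longleftrightarrow> u \<noteq> v \<and> (\<exists>i\<in>{1..n}. u \<in> T i \<and> v \<in> T i)"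
  unfolding edge_iff by (cases "u = v") auto

lemma adjacentI: "i \<in> {1..n} \<Longrightarrow> u \<in> T i \<Longrightarrow> v \<in> T i \<Longrightarrow> u \<noteq> v \<Longrightarrow> {u, v} \<in> edges G"
  using adjacent_iff by blast

lemma simple: "simple_graph G"
  unfolding simple_graph_def using edge_iff verts_G by blast

text \<open>Everything about which vertex lies in which tetrahedron follows from this.\<close>

lemma common_vertex:
  assumes "i \<in> {1..n}" "j \<in> {1..n}" "i < j" "x \<in> T i" "x \<in> T j"
  shows "j = Suc i \<and> x = s i"
proof -
  have "j = Suc i" using far[of i j] assms by fastforce
  then show ?thesis using shared[of i] assms by auto
qed

lemma s_in: "i \<in> {1..<n} \<Longrightarrow> s i \<in> T i \<and> s i \<in> T (Suc i)"
  using shared by blast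

lemma s_in_iff:
  assumes "i \<in> {1..<n}" "j \<in> {1..n}"
  shows "s i \<in> T j \<longleftrightarrow> j = i \<or> j = Suc i"
proof
  assume *: "s i \<in> T j"
  consider "j < i" | "j = i" | "j = Suc i" | "j > Suc i" by linarith
  then show "j = i \<or> j = Suc i"
  proof cases
    case 1
    then have "j = i \<or> Suc i = Suc j" using common_vertex[of j "Suc i" "s i"] * s_in[OF assms(1)] assms by auto
    then show ?thesis using 1 by simp
  next
    case 4
    then show ?thesis using common_vertex[of i j "s i"] * s_in[OF assms(1)] assms by auto
  qed auto
qed (use s_in assms in auto)

text \<open>Over-estimating the shared vertices is harmless for the first and the last
  tetrahedron, where \<open>s 0\<close> or \<open>s n\<close> is an arbitrary vertex.\<close>

lemma T_subset: "i \<in> {1..n} \<Longrightarrow> T i \<subseteq> inner i \<union> {s i, s (i - 1)}"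
  unfolding inner_def by (auto dest: s_in_iff[THEN iffD1, rotated 2])

lemma card_inner: "i \<in> {1..n} \<Longrightarrow> 2 \<le> card (inner i)"
proof -
  assume i: "i \<in> {1..n}"
  have fin: "finite (inner i)" unfolding inner_def using finite_T[OF i] by simp
  have "4 \<le> card (inner i \<union> {s i, s (i - 1)})"
    using card_mono[OF _ T_subset[OF i]] card_T[OF i] fin by simp
  also have "\<dots> \<le> card (inner i) + card {s i, s (i - 1)}" by (rule card_Un_le)
  also have "\<dots> \<le> card (inner i) + 2" by (simp add: card_insert_if)
  finally show ?thesis by simp
qed

lemma inners_eq: "inners = (\<Union>i\<in>{1..n}. inner i)"
  unfolding inners_def inner_def verts_G by blast

lemma inner_in_inners: "i \<in> {1..n} \<Longrightarrow> x \<in> inner i \<Longrightarrow> x \<in> inners"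
  unfolding inners_eq by blast

lemma inner_unique:
  assumes "i \<in> {1..n}" "j \<in> {1..n}" "x \<in> inner i" "x \<in> T j"
  shows "j = i"
proof (rule ccontr)
  assume "j \<noteq> i"
  then have "\<exists>k\<in>{1..<n}. x = s k"
    using common_vertex[of i j x] common_vertex[of j i x] assms unfolding inner_def
    by (cases "i < j") auto
  then show False using assms(3) unfolding inner_def by blast
qed

lemma card_verts: "card (verts G) = 3 * n + 1"
proof -
  have "card (\<Union>i\<in>{1..m}. T i) = 3 * m + 1" if "1 \<le> m" "m \<le> n" for m
    using that
  proof (induction m rule: nat_induct_at_least)
    case base
    then show ?case using card_T[of 1] by simp
  next
    case (Suc m)
    let ?U = "\<Union>i\<in>{1..m}. T i"
    have fin: "finite ?U" "finite (T (Suc m))" using finite_T Suc.prems by auto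
    have "?U \<inter> T (Suc m) = {s m}"
    proof (rule set_eqI, rule iffI)
      fix x assume "x \<in> ?U \<inter> T (Suc m)"
      then obtain k where "k \<in> {1..m}" "x \<in> T k" "x \<in> T (Suc m)" by blast
      then show "x \<in> {s m}" using common_vertex[of k "Suc m" x] Suc.prems by simp
    next
      fix x assume "x \<in> {s m}"
      then show "x \<in> ?U \<inter> T (Suc m)" using s_in[of m] Suc.prems Suc.hyps by auto
    qed
    moreover have "(\<Union>i\<in>{1..Suc m}. T i) = ?U \<union> T (Suc m)"
      by (auto simp: atLeastAtMostSuc_conv)
    ultimately show ?case
      using card_Un_Int[OF fin] card_T[of "Suc m"] Suc by simp
  qed
  from this[of n] show ?thesis using n_pos verts_G by simp
qed

lemma card_inners: "card inners = 2 * n + 2"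
proof -
  have "s i \<in> verts G" if "i \<in> {1..<n}" for i
    using s_in[OF that] that verts_G by auto
  then have "s ` {1..<n} \<subseteq> verts G" by blast
  then have "card inners = card (verts G) - card (s ` {1..<n})"
    unfolding inners_def by (intro card_Diff_subset) auto
  then show ?thesis using card_verts card_image[OF inj_s] n_pos by simp
qed

text \<open>By induction along the chain, every vertex reaches a fixed vertex \<open>z\<close> of the first
  tetrahedron.\<close>

lemma connected:
  assumes "u \<in> verts G" "v \<in> verts G"
  shows "\<exists>p. path_between G u p v"
proof -
  let ?E = "{(x, y). {x, y} \<in> edges G}"
  have "sym ?E" by (rule symI) (simp add: insert_commute)
  then have sym: "(x, y) \<in> ?E\<^sup>* \<Longrightarrow> (y, x) \<in> ?E\<^sup>*" for x y
    by (rule symD[OF sym_rtrancl])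
  have block: "(x, y) \<in> ?E\<^sup>*" if "i \<in> {1..n}" "x \<in> T i" "y \<in> T i" for x y i
  proof (cases "x = y")
    case False
    then have "{x, y} \<in> edges G" using that adjacent_iff by blast
    then show ?thesis by blast
  qed simp
  have "T 1 \<noteq> {}" using card_T[of 1] n_pos by auto
  then obtain z where z: "z \<in> T 1" by blast
  have reach: "x \<in> T m \<Longrightarrow> (x, z) \<in> ?E\<^sup>*" if "1 \<le> m" "m \<le> n" for m x
    using that
  proof (induction m arbitrary: x rule: nat_induct_at_least)
    case base
    show ?case by (rule block[OF _ base(1) z]) (use n_pos in simp)
  next
    case (Suc m)
    then have m: "s m \<in> T m" "s m \<in> T (Suc m)" using s_in[of m] by auto
    have "Suc m \<in> {1..n}" using Suc.prems by simp
    then have "(x, s m) \<in> ?E\<^sup>*" using Suc.prems(1) m(2) by (rule block)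
    moreover have "(s m, z) \<in> ?E\<^sup>*" by (rule Suc.IH[OF m(1)]) (use Suc.prems in simp)
    ultimately show ?case by (rule rtrancl_trans)
  qed
  have to_z: "(x, z) \<in> ?E\<^sup>*" if x: "x \<in> verts G" for x
  proof -
    obtain m where m: "m \<in> {1..n}" "x \<in> T m" using x verts_G by blast
    show ?thesis by (rule reach[OF _ _ m(2)]) (use m(1) in auto)
  qed
  have "(u, v) \<in> ?E\<^sup>*"
    using to_z[OF assms(1)] sym[OF to_z[OF assms(2)]] by (rule rtrancl_trans)
  then show ?thesis using simple assms(2) by (rule rtrancl_imp_path)
qed

section \<open>Lower bound\<close>

text \<open>From every vertex except \<open>x\<close> itself, an inner vertex \<open>x\<close> does not influence the distance of
  its edges, because \<open>c\<close> is adjacent to all the other neighbours of \<open>x\<close>.\<close>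

lemma edge_dist_at_inner:
  assumes "i \<in> {1..n}" "x \<in> inner i" "c \<in> T i" "c \<noteq> x" "w \<in> verts G" "w \<noteq> x"
  shows "edge_dist G {c, x} w = gdist G c w"
proof -
  have x: "x \<in> T i" using assms(2) by (simp add: inner_def)
  then obtain p where p: "path_between G x p w"
    using connected[of x w] assms(1,5) verts_G by blast
  have "y = c \<or> {c, y} \<in> edges G" if "{x, y} \<in> edges G" for y
    using that inner_unique[OF assms(1) _ assms(2)] assms(1,3) adjacent_iff by metis
  then have "gdist G c w \<le> gdist G x w"
    using gdist_dominated[OF p] assms verts_G by blast
  then show ?thesis by (simp add: edge_dist_pair)
qed

text \<open>Otherwise the edges joining \<open>x\<close> and \<open>y\<close> to a common neighbour \<open>c\<close> would both have the distances
  of \<open>c\<close>, as seen from \<open>S\<close>.\<close>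

lemma missing_inner_unique:
  assumes S: "edge_resolving G S"
    and ij: "i \<in> {1..n}" "j \<in> {1..n}" "j = i \<or> j = Suc i"
    and x: "x \<in> inner i" "x \<notin> S" and y: "y \<in> inner j" "y \<notin> S"
  shows "x = y"
proof (rule ccontr)
  assume "x \<noteq> y"
  \<comment> \<open>In one tetrahedron any third vertex serves as \<open>c\<close>; in consecutive ones it has to be the
    shared vertex.\<close>
  obtain c where c: "c \<in> T i" "c \<in> T j" "c \<noteq> x" "c \<noteq> y"
  proof (cases "j = i")
    case True
    have "\<not> T i \<subseteq> {x, y}"
      using card_mono[of "{x, y}" "T i"] card_T[OF ij(1)] by (auto simp: card_insert_if split: if_splits)
    then show ?thesis using that True by blast
  next
    case False
    then have "i \<in> {1..<n}" using ij by auto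
    then have "s i \<noteq> x" "s i \<noteq> y" using x(1) y(1) unfolding inner_def by auto
    moreover have "s i \<in> T i" "s i \<in> T j" using s_in[OF \<open>i \<in> {1..<n}\<close>] False ij(3) by auto
    ultimately show ?thesis using that by blast
  qed
  have "edge_dist G {c, x} w = edge_dist G {c, y} w" if "w \<in> S" for w
  proof -
    have "w \<in> verts G" "w \<noteq> x" "w \<noteq> y"
      using that S x y unfolding edge_resolving_def by auto
    then show ?thesis
      using edge_dist_at_inner[OF ij(1) x(1) c(1,3)] edge_dist_at_inner[OF ij(2) y(1) c(2,4)]
      by simp
  qed
  moreover have "x \<in> T i" "y \<in> T j" using x(1) y(1) by (simp_all add: inner_def)
  then have "{c, x} \<in> edges G" "{c, y} \<in> edges G"
    using adjacentI[OF ij(1) c(1)] adjacentI[OF ij(2) c(2)] c(3,4) by simp_all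
  moreover have "{c, x} \<noteq> {c, y}" using \<open>x \<noteq> y\<close> by (simp add: doubleton_eq_iff)
  ultimately show False using S unfolding edge_resolving_def by metis
qed

lemma lower_bound:
  assumes "even n" and S: "edge_resolving G S" "finite S"
  shows "3 * n div 2 + 2 \<le> card S"
proof -
  have finP: "finite inners" using finite_verts by (simp add: inners_def)
  have "\<forall>x\<in>inners. \<exists>i. i \<in> {1..n} \<and> x \<in> inner i" unfolding inners_eq by blast
  from bchoice[OF this] obtain b where b: "\<forall>x\<in>inners. b x \<in> {1..n} \<and> x \<in> inner (b x)" ..
  \<comment> \<open>Pairing the tetrahedra \<open>2 k - 1\<close> and \<open>2 k\<close>; the last one has a partner because \<open>n\<close> is
    even.\<close>
  let ?g = "\<lambda>x. (b x + 1) div 2"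
  have "inj_on ?g (inners - S)"
  proof (rule inj_onI)
    fix x y assume x: "x \<in> inners - S" and y: "y \<in> inners - S" and g: "?g x = ?g y"
    have bx: "b x \<in> {1..n}" "x \<in> inner (b x)" "x \<notin> S" using b x by auto
    have y': "b y \<in> {1..n}" "y \<in> inner (b y)" "y \<notin> S" using b y by auto
    have "b y \<le> Suc (b x)" "b x \<le> Suc (b y)"
      using g by linarith+
    then consider "b y = b x \<or> b y = Suc (b x)" | "b x = b y \<or> b x = Suc (b y)"
      by linarith
    then show "x = y"
    proof cases
      case 1
      show ?thesis by (rule missing_inner_unique[OF S(1) bx(1) y'(1) 1 bx(2,3) y'(2,3)])
    next
      case 2
      show ?thesis by (rule missing_inner_unique[OF S(1) y'(1) bx(1) 2 y'(2,3) bx(2,3), symmetric])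
    qed
  qed
  moreover have "?g ` (inners - S) \<subseteq> {1..n div 2}"
  proof (rule image_subsetI)
    fix x assume "x \<in> inners - S"
    then have "1 \<le> b x" "b x \<le> n" using b by auto
    then have "1 \<le> ?g x" "?g x \<le> n div 2" using \<open>even n\<close> by (auto elim!: evenE)
    then show "?g x \<in> {1..n div 2}" by simp
  qed
  ultimately have "card (inners - S) \<le> n div 2"
    using card_inj_on_le[of ?g "inners - S" "{1..n div 2}"] by simp
  moreover have "card ((inners - S) \<union> (inners \<inter> S)) = card (inners - S) + card (inners \<inter> S)"
    using finP by (intro card_Un_disjoint) auto
  then have "card inners = card (inners - S) + card (inners \<inter> S)" by (simp add: Un_Diff_Int)
  moreover have "card (inners \<inter> S) \<le> card S" using S(2) by (simp add: card_mono)
  ultimately show ?thesis using card_inners by linarith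
qed

section \<open>Upper bound\<close>

lemma edge_pair: "e \<in> edges G \<Longrightarrow> \<exists>u v. e = {u, v}"
  unfolding edge_iff card_2_iff by blast

lemma edge_dist_eq_0_iff:
  assumes "e \<in> edges G" "w \<in> verts G"
  shows "edge_dist G e w = 0 \<longleftrightarrow> w \<in> e"
proof -
  obtain u v where e: "e = {u, v}" using edge_pair[OF assms(1)] by blast
  then have "u \<in> verts G" "v \<in> verts G" using assms(1) simple by (auto simp: simple_graph_def)
  then obtain p q where pq: "path_between G u p w" "path_between G v q w"
    using connected assms(2) by blast
  have "gdist G u w = 0 \<longleftrightarrow> u = w" "gdist G v w = 0 \<longleftrightarrow> v = w"
    using gdist_eq_0_iff[OF pq(1)] gdist_eq_0_iff[OF pq(2)] by simp_all
  then show ?thesis unfolding e edge_dist_pair by (auto simp: min_def)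
qed

text \<open>A landmark that is inner in a tetrahedron has no neighbours elsewhere, so the threshold 1
  detects exactly the edges that touch this tetrahedron.\<close>

lemma edge_dist_le_1_iff:
  assumes "e \<in> edges G" "i \<in> {1..n}" "w \<in> inner i"
  shows "edge_dist G e w \<le> 1 \<longleftrightarrow> e \<inter> T i \<noteq> {}"
proof -
  have w: "w \<in> T i" "w \<in> verts G" using assms(2,3) verts_G by (auto simp: inner_def)
  obtain u v where e: "e = {u, v}" using edge_pair[OF assms(1)] by blast
  then have uv: "u \<in> verts G" "v \<in> verts G" using assms(1) simple by (auto simp: simple_graph_def)
  have "gdist G x w \<le> 1 \<longleftrightarrow> x \<in> T i" if x: "x \<in> verts G" for x
  proof -
    obtain p where p: "path_between G x p w" using connected[OF x w(2)] by blast
    show ?thesis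
      unfolding gdist_le_1_iff[OF p] adjacent_iff
      using inner_unique[OF assms(2) _ assms(3)] w(1) assms(2) by blast
  qed
  then show ?thesis using uv unfolding e edge_dist_pair by (auto simp: min_le_iff_disj)
qed

text \<open>The vertex \<open>b i\<close> is the inner vertex omitted from the tetrahedron \<open>i\<close> if \<open>i\<close> is odd.  A landmark
  remains in each tetrahedron since it has at least two inner vertices.\<close>

lemma landmarks_exist:
  assumes "even n"
  shows "\<exists>S b. S \<subseteq> inners \<and> card S = 3 * n div 2 + 2 \<and>
    (\<forall>i\<in>{1..n}. S \<inter> inner i \<noteq> {} \<and> (\<forall>x\<in>inner i. x \<in> S \<or> odd i \<and> x = b i))"
proof -
  have "inner i \<noteq> {}" if "i \<in> {1..n}" for i
    using card_inner[OF that] by auto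
  then have "\<forall>i\<in>{1..n}. \<exists>x. x \<in> inner i" by blast
  from bchoice[OF this] obtain b where "\<forall>i\<in>{1..n}. b i \<in> inner i" ..
  then have b: "b i \<in> inner i" if "i \<in> {1..n}" for i using that by blast
  let ?O = "(\<lambda>k. 2 * k + 1) ` {..<n div 2}"
  have O: "i \<in> {1..n} \<and> odd i" if "i \<in> ?O" for i using that by auto
  have b_block: "j = i" if "i \<in> {1..n}" "j \<in> {1..n}" "b j \<in> inner i" for i j
  proof -
    have "b j \<in> T j" using b[OF that(2)] by (simp add: inner_def)
    then show ?thesis using inner_unique[OF that] by simp
  qed
  define S where "S = inners - b ` ?O"
  have b_inners: "b ` ?O \<subseteq> inners" using b O inner_in_inners by blast
  have "inj_on b {1..n}"
  proof (rule inj_onI)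
    fix i j assume ij: "i \<in> {1..n}" "j \<in> {1..n}" "b i = b j"
    then have "b j \<in> inner i" using b[of i] by simp
    then show "i = j" using b_block[OF ij(1,2)] by simp
  qed
  then have "inj_on b ?O" by (rule inj_on_subset) (use O in blast)
  then have "card (b ` ?O) = card ?O" by (rule card_image)
  moreover have "card ?O = n div 2" by (simp add: card_image inj_on_def)
  ultimately have "card S = 2 * n + 2 - n div 2"
    unfolding S_def using card_Diff_subset[OF _ b_inners] card_inners by simp
  then have "card S = 3 * n div 2 + 2" using assms by (auto elim!: evenE)
  moreover have "S \<inter> inner i \<noteq> {}" if i: "i \<in> {1..n}" for i
  proof -
    have "\<not> inner i \<subseteq> {b i}"
      using card_inner[OF i] card_mono[of "{b i}" "inner i"] by auto
    then obtain w where w: "w \<in> inner i" "w \<noteq> b i" by blast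
    have "w \<noteq> b j" if "j \<in> {1..n}" for j
      using b_block[OF i that] w by auto
    then have "w \<notin> b ` ?O" using O by blast
    then show ?thesis using w(1) inner_in_inners[OF i w(1)] unfolding S_def by blast
  qed
  moreover have "x \<in> S \<or> odd i \<and> x = b i" if x: "i \<in> {1..n}" "x \<in> inner i" for i x
  proof (cases "x \<in> S")
    case False
    then obtain j where j: "j \<in> ?O" "x = b j"
      using inner_in_inners[OF x] unfolding S_def by blast
    then show ?thesis using b_block[OF x(1), of j] O[OF j(1)] x(2) by blast
  qed blast
  moreover have "S \<subseteq> inners" by (auto simp: S_def)
  ultimately show ?thesis by (intro exI[of _ S] exI[of _ b]) simp
qed

text \<open>The tetrahedra touched by an edge reveal which shared vertices it contains, and \<open>S\<close>
  reveals its inner vertices up to \<open>b\<close>.  As both edges have two vertices, agreement outside \<open>b\<close>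
  forces agreement at \<open>b\<close>.\<close>

lemma same_block_edges_eq:
  assumes i: "i \<in> {1..n}" and e: "e \<subseteq> T i" "card e = 2" and f: "f \<subseteq> T i" "card f = 2"
    and S_eq: "e \<inter> S = f \<inter> S"
    and meets: "\<And>k. k \<in> {1..n} \<Longrightarrow> e \<inter> T k = {} \<longleftrightarrow> f \<inter> T k = {}"
    and cover: "\<And>x. x \<in> inner i \<Longrightarrow> x \<in> S \<or> x = b"
  shows "e = f"
proof -
  \<comment> \<open>A shared vertex of the tetrahedron \<open>i\<close> is its whole intersection with a neighbouring
    tetrahedron \<open>l\<close>.\<close>
  have cut: "s k \<in> e \<longleftrightarrow> s k \<in> f" if k: "k \<in> {1..<n}" "s k \<in> T i" for k
  proof -
    have "i = k \<or> i = Suc k" using s_in_iff[OF k(1) i] k(2) by simp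
    then have "\<exists>l\<in>{1..n}. T i \<inter> T l = {s k}"
    proof
      assume "i = k"
      then show ?thesis using shared[OF k(1)] k(1) by (intro bexI[of _ "Suc k"]) auto
    next
      assume "i = Suc k"
      then show ?thesis using shared[OF k(1)] k(1) by (intro bexI[of _ k]) auto
    qed
    then obtain l where l: "l \<in> {1..n}" "T i \<inter> T l = {s k}" by blast
    have "s k \<in> g \<longleftrightarrow> g \<inter> T l \<noteq> {}" if "g \<subseteq> T i" for g
    proof -
      have "g \<inter> T l = g \<inter> {s k}" using that l(2) by blast
      then show ?thesis by auto
    qed
    then show ?thesis using meets[OF l(1)] e(1) f(1) by simp
  qed
  have "x \<in> e \<longleftrightarrow> x \<in> f" if x: "x \<in> T i" "x \<noteq> b" for x
  proof (cases "x \<in> inner i")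
    case True
    then have "x \<in> S" using cover x(2) by blast
    then show ?thesis using S_eq by blast
  next
    case False
    then obtain k where "k \<in> {1..<n}" "x = s k" using x(1) unfolding inner_def by blast
    then show ?thesis using cut x(1) by simp
  qed
  then have eq: "e - {b} = f - {b}" using e(1) f(1) by blast
  then have "b \<in> e \<longleftrightarrow> b \<in> f"
    using card_Diff_singleton_if[of e b] card_Diff_singleton_if[of f b] e(2) f(2)
    by (simp split: if_splits)
  then show ?thesis using eq by blast
qed

text \<open>Each edge touches the tetrahedron of the other, so the tetrahedra are consecutive and both
  edges contain the shared vertex \<open>s i\<close>.  Their other ends \<open>x\<close> and \<open>y\<close> are not in \<open>S\<close>, since the
  edges agree on \<open>S\<close>.  Nor is \<open>x\<close> or \<open>y\<close> shared: its edge would touch a further tetrahedron,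
  too far away to be touched by the other edge.\<close>

lemma different_block_edges:
  assumes ij: "i \<in> {1..n}" "j \<in> {1..n}" "i < j"
    and e: "e \<subseteq> T i" "card e = 2" and f: "f \<subseteq> T j" "card f = 2"
    and S_eq: "e \<inter> S = f \<inter> S"
    and meets: "\<And>k. k \<in> {1..n} \<Longrightarrow> e \<inter> T k = {} \<longleftrightarrow> f \<inter> T k = {}"
  shows "j = Suc i \<and> \<not> inner i \<subseteq> S \<and> \<not> inner j \<subseteq> S"
proof -
  have other: "\<exists>x. x \<in> g \<and> x \<noteq> z" if "card g = 2" for g and z :: 'a
  proof -
    obtain u v where "g = {u, v}" "u \<noteq> v" using \<open>card g = 2\<close> by (auto simp: card_2_iff)
    then show ?thesis by (cases "u = z") auto
  qed
  have ne: "e \<noteq> {}" "f \<noteq> {}" using e(2) f(2) by auto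
  have "e \<inter> T i \<noteq> {}" using ne e(1) by blast
  then have "f \<inter> T i \<noteq> {}" using meets[OF ij(1)] by simp
  then obtain z where "z \<in> f" "z \<in> T i" "z \<in> T j" using f(1) by blast
  then have j: "j = Suc i" using common_vertex[OF ij] by blast
  obtain x where x: "x \<in> e" "x \<noteq> s i" using other[OF e(2)] by blast
  obtain y where y: "y \<in> f" "y \<noteq> s i" using other[OF f(2)] by blast
  have xT: "x \<in> T i" and yT: "y \<in> T j" using x(1) y(1) e(1) f(1) by auto
  have "x \<notin> T j" "y \<notin> T i" using common_vertex[OF ij] xT yT x(2) y(2) by auto
  then have "x \<notin> f" "y \<notin> e" using e(1) f(1) by auto
  then have notS: "x \<notin> S" "y \<notin> S" using S_eq x(1) y(1) by auto
  have "x \<in> inner i"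
  proof (rule ccontr)
    assume "x \<notin> inner i"
    then obtain k where k: "k \<in> {1..<n}" "x = s k" using xT unfolding inner_def by blast
    then have "i = Suc k" using s_in_iff[OF k(1) ij(1)] xT x(2) by auto
    have "e \<inter> T k \<noteq> {}" using s_in[OF k(1)] k(2) x(1) by blast
    then have "f \<inter> T k \<noteq> {}" using meets[of k] k(1) by simp
    moreover have "T k \<inter> T j = {}" using far[of k j] k(1) ij(2) j \<open>i = Suc k\<close> by simp
    ultimately show False using f(1) by blast
  qed
  moreover have "y \<in> inner j"
  proof (rule ccontr)
    assume "y \<notin> inner j"
    then obtain k where k: "k \<in> {1..<n}" "y = s k" using yT unfolding inner_def by blast
    then have "j = k" using s_in_iff[OF k(1) ij(2)] yT y(2) j by auto
    have "f \<inter> T (Suc k) \<noteq> {}" using s_in[OF k(1)] k(2) y(1) by blast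
    then have "e \<inter> T (Suc k) \<noteq> {}" using meets[of "Suc k"] k(1) by simp
    moreover have "T i \<inter> T (Suc k) = {}" using far[of i "Suc k"] k(1) ij(1) j \<open>j = k\<close> by simp
    ultimately show False using e(1) by blast
  qed
  ultimately show ?thesis using j notS by blast
qed

lemma upper_bound:
  assumes "even n"
  shows "\<exists>S. edge_resolving G S \<and> finite S \<and> card S = 3 * n div 2 + 2"
proof -
  obtain S b where S_inners: "S \<subseteq> inners" and card_S: "card S = 3 * n div 2 + 2"
    and S: "\<forall>i\<in>{1..n}. S \<inter> inner i \<noteq> {} \<and> (\<forall>x\<in>inner i. x \<in> S \<or> odd i \<and> x = b i)"
    using landmarks_exist[OF assms] by blast
  have hit: "S \<inter> inner i \<noteq> {}" if "i \<in> {1..n}" for i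
    using S that by blast
  have cover: "x \<in> S \<or> odd i \<and> x = b i" if "i \<in> {1..n}" "x \<in> inner i" for i x
    using S that by blast
  have S_verts: "S \<subseteq> verts G" using S_inners by (auto simp: inners_def)
  have full: "inner i \<subseteq> S" if "i \<in> {1..n}" "even i" for i
    using cover[OF that(1)] that(2) by blast
  have "e = f"
    if e: "e \<in> edges G" and f: "f \<in> edges G"
      and same: "\<And>w. w \<in> S \<Longrightarrow> edge_dist G e w = edge_dist G f w" for e f
  proof -
    have "x \<in> e \<longleftrightarrow> x \<in> f" if "x \<in> S" for x
    proof -
      have "x \<in> verts G" using that S_verts by blast
      then show ?thesis
        using edge_dist_eq_0_iff[OF e] edge_dist_eq_0_iff[OF f] same[OF that] by metis
    qed
    then have S_eq: "e \<inter> S = f \<inter> S" by blast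
    have meets: "e \<inter> T k = {} \<longleftrightarrow> f \<inter> T k = {}" if k: "k \<in> {1..n}" for k
    proof -
      obtain w where w: "w \<in> S" "w \<in> inner k" using hit[OF k] by blast
      show ?thesis
        using edge_dist_le_1_iff[OF e k w(2)] edge_dist_le_1_iff[OF f k w(2)] same[OF w(1)]
        by simp
    qed
    obtain i where i: "i \<in> {1..n}" "e \<subseteq> T i" "card e = 2" using e edge_iff by blast
    obtain j where j: "j \<in> {1..n}" "f \<subseteq> T j" "card f = 2" using f edge_iff by blast
    consider "i = j" | "i < j" | "j < i" by linarith
    then show "e = f"
    proof cases
      case 1
      have fi: "f \<subseteq> T i" using j(2) 1 by simp
      have cov: "x \<in> S \<or> x = b i" if "x \<in> inner i" for x using cover[OF i(1) that] by blast
      show ?thesis by (rule same_block_edges_eq[OF i fi j(3) S_eq meets cov])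
    next
      case 2
      have "j = Suc i \<and> \<not> inner i \<subseteq> S \<and> \<not> inner j \<subseteq> S"
        by (rule different_block_edges[OF i(1) j(1) 2 i(2,3) j(2,3) S_eq meets])
      then show ?thesis using full[OF i(1)] full[OF j(1)] by auto
    next
      case 3
      have "i = Suc j \<and> \<not> inner j \<subseteq> S \<and> \<not> inner i \<subseteq> S"
        by (rule different_block_edges[OF j(1) i(1) 3 j(2,3) i(2,3) S_eq[symmetric] meets[symmetric]])
      then show ?thesis using full[OF i(1)] full[OF j(1)] by auto
    qed
  qed
  then have "edge_resolving G S"
    unfolding edge_resolving_def using S_verts by metis
  then show ?thesis using card_S finite_subset[OF S_verts finite_verts] by blast
qed

end

theorem theorem1:
  fixes G :: "'a graph" and n :: nat
  assumes "even n" and "n \<ge> 2" and "is_chain_silicate n G"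
  shows "edge_metric_dim G = 3 * n div 2 + 2"
proof -
  obtain R :: "nat \<Rightarrow> 'a graph" and s where
    R: "\<forall>i\<in>{1..n}. is_K4 (R i)" "verts G = (\<Union>i\<in>{1..n}. verts (R i))"
      "edges G = (\<Union>i\<in>{1..n}. edges (R i))"
      "\<forall>i\<in>{1..<n}. verts (R i) \<inter> verts (R (i + 1)) = {s i}" "inj_on s {1..<n}"
      "\<forall>i\<in>{1..n}. \<forall>j\<in>{1..n}. i + 2 \<le> j \<longrightarrow> verts (R i) \<inter> verts (R j) = {}"
    using assms(3) unfolding is_chain_silicate_def
    by (elim exE conjE) (rule that)
  interpret silicate_chain G n R s
  proof
    show "verts G = (\<Union>i\<in>{1..n}. verts (R i))" "edges G = (\<Union>i\<in>{1..n}. edges (R i))"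
      "inj_on s {1..<n}"
      by fact+
    show "1 \<le> n" using assms(2) by simp
    show "is_K4 (R i)" if "i \<in> {1..n}" for i
      using R(1) that by blast
    show "verts (R i) \<inter> verts (R (Suc i)) = {s i}" if "i \<in> {1..<n}" for i
      using bspec[OF R(4) that] by simp
    show "verts (R i) \<inter> verts (R j) = {}"
      if "i \<in> {1..n}" "j \<in> {1..n}" "i + 2 \<le> j" for i j
      using bspec[OF bspec[OF R(6) that(1)] that(2)] that(3) by simp
  qed
  show ?thesis
    unfolding edge_metric_dim_def
  proof (rule Least_equality)
    show "\<exists>S. edge_resolving G S \<and> finite S \<and> card S = 3 * n div 2 + 2"
      using assms(1) by (rule upper_bound)
    show "3 * n div 2 + 2 \<le> k" if "\<exists>S. edge_resolving G S \<and> finite S \<and> card S = k" for k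
      using that lower_bound[OF assms(1)] by auto
  qed
qed

end
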